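(* Let $k,n\ge 1$ be integers, let $\Sigma$ be the set of assignment indicator vectors of $n$ data points to $k$ clusters, let $E:\Sigma\to\mathbb{R}$ be an arbitrary energy function, and let $\beta>0$, $\Gamma>0$. With $p_{\mathrm{QA}}$ and $p_{\mathrm{SA}}$ as defined in the context, define for each integer $m\ge 1$ the probability distribution on $\Sigma^m$ $$p_{\mathrm{QA\text{-}ST}}(\sigma_1,\dots,\sigma_m;\beta,\Gamma)=\frac{1}{Z}\prod_{j=1}^{m}p_{\mathrm{SA}}(\sigma_j;\beta/m)\,e^{s(\sigma_j,\sigma_{j+1})f(\beta,\Gamma)},\qquad \sigma_{m+1}:=\sigma_1,$$ where $Z$ is the normalization constant (making the sum over all $(\sigma_1,\dots,\sigma_m)\in\Sigma^m$ equal to $1$), $$s(\sigma_j,\sigma_{j+1})=\frac1n\sum_{i=1}^n\delta(\tilde\sigma_{j,i},\tilde\sigma_{j+1,i}),\qquad f(\beta,\Gamma)=n\log\left(1+\frac{k}{e^{k\beta\Gamma/m}-1}\right).$$ Then for every $\sigma_1\in\Sigma$, as $m\to\infty$ (with $k,n,E,\beta,\Gamma$ fixed), $$p_{\mathrm{QA}}(\sigma_1;\beta,\Gamma)=\sum_{\sigma_2\in\Sigma}\cdots\sum_{\sigma_m\in\Sigma}p_{\mathrm{QA\text{-}ST}}(\sigma_1,\sigma_2,\dots,\sigma_m;\beta,\Gamma)+O\left(\frac1m\right).$$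
   Context: Assignments: the assignment of a single data point to one of $k$ clusters is a standard basis vector of $\mathbb{R}^k$. An assignment of $n$ data points is $\sigma=\bigotimes_{i=1}^n\tilde\sigma_i\in\mathbb{R}^{k^n}$ (Kronecker product), where each $\tilde\sigma_i$ is a standard basis vector of $\mathbb{R}^k$; $\Sigma$ denotes the set of all these $k^n$ vectors, which is exactly the standard basis of $\mathbb{R}^{k^n}$. For $\sigma_j\in\Sigma$ write $\sigma_j=\bigotimes_{i=1}^n\tilde\sigma_{j,i}$. $\delta(a,b)=1$ if $a=b$ and $0$ otherwise. Classical distribution: $p_{\mathrm{SA}}(\sigma;\beta)=\exp(-\beta E(\sigma))/\sum_{\sigma'\in\Sigma}\exp(-\beta E(\sigma'))$. Hamiltonians: $\mathcal{H}_c$ is the $k^n\times k^n$ diagonal matrix whose diagonal entry at the position indicated by the basis vector $\sigma\in\Sigma$ is $E(\sigma)$. $\mathcal{H}_q=\sum_{i=1}^n\rho_i$, where $\rho_i=\left(\bigotimes_{j=1}^{i-1}\mathbb{E}_k\right)\otimes\rho\otimes\left(\bigotimes_{j=i+1}^{n}\mathbb{E}_k\right)$, $\rho=\Gamma(\mathbb{E}_k-\mathbb{1}_k)$, $\mathbb{E}_k$ is the $k\times k$ identity matrix and $\mathbb{1}_k$ is the $k\times k$ matrix all of whose entries are $1$. $\mathcal{H}=\mathcal{H}_c+\mathcal{H}_q$. Quantum distribution: $p_{\mathrm{QA}}(\sigma;\beta,\Gamma)=\frac{1}{Z}\sigma^Te^{-\beta\mathcal{H}}\sigma$ for $\sigma\in\Sigma$,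 where $e^{A}$ is the matrix exponential and $Z=\sum_{\sigma\in\Sigma}\sigma^Te^{-\beta\mathcal{H}}\sigma$ is the normalization constant. (The symbol $Z$ denotes the normalization constant of the distribution in which it appears; these constants differ.) *)

theory Defs
  imports "HOL-Analysis.Analysis" "HOL-Library.Landau_Symbols"
begin

text \<open>
  The \<open>n\<close> data points are the elements of a finite type \<open>'n\<close> and the \<open>k\<close> clusters
  those of a finite type \<open>'k\<close>; so \<open>n = CARD('n)\<close>, \<open>k = CARD('k)\<close>, and both are at least 1.
  The \<open>k^n\<close> coordinates of a Kronecker product over all data points are labelled by the
  multi-indices of type \<open>'n \<Rightarrow> 'k\<close> instead of by their lexicographic rank.
\<close>

definition kron_vec :: "('n::finite \<Rightarrow> real^'k::finite) \<Rightarrow> real^('n \<Rightarrow> 'k)" where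
  "kron_vec v = (\<chi> a. \<Prod>i\<in>UNIV. v i $ a i)"

definition kron_mat :: "('n::finite \<Rightarrow> real^'k^'k::finite) \<Rightarrow> real^('n \<Rightarrow> 'k)^('n \<Rightarrow> 'k)" where
  "kron_mat A = (\<chi> a b. \<Prod>i\<in>UNIV. A i $ a i $ b i)"

text \<open>On \<open>real^'k\<close>, \<open>Basis\<close> is exactly the set of standard basis vectors.\<close>

definition Assignments :: "(real^('n::finite \<Rightarrow> 'k::finite)) set" where
  "Assignments = {kron_vec v | v. \<forall>i. v i \<in> Basis}"

definition factors :: "real^('n::finite \<Rightarrow> 'k::finite) \<Rightarrow> 'n \<Rightarrow> real^'k" where
  "factors \<sigma> = (THE v. (\<forall>i. v i \<in> Basis) \<and> \<sigma> = kron_vec v)"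

lemma kron_vec_axis: "kron_vec (\<lambda>i. axis (c i) 1) = axis c 1"
proof (rule vec_eq_iff[THEN iffD2], rule allI)
  fix a :: "'a \<Rightarrow> 'b"
  show "kron_vec (\<lambda>i. axis (c i) 1) $ a = axis c 1 $ a"
  proof (cases "a = c")
    case True
    then show ?thesis by (simp add: kron_vec_def axis_def)
  next
    case False
    then obtain i where "a i \<noteq> c i" by blast
    then have "(\<Prod>i\<in>UNIV. (axis (c i) 1 :: real^'b) $ a i) = 0"
      by (intro prod_zero) (auto simp: axis_def)
    with False show ?thesis by (simp add: kron_vec_def axis_def)
  qed
qed

lemma Basis_vec_real: "(Basis :: (real^'k::finite) set) = range (\<lambda>c. axis c 1)"
  by (auto simp: Basis_vec_def)

lemma Basis_family:
  assumes "\<forall>i. v i \<in> (Basis :: (real^'k::finite) set)"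
  obtains c where "v = (\<lambda>i. axis (c i) 1)"
proof -
  from assms have "\<forall>i. \<exists>c. v i = axis c 1" by (auto simp: Basis_vec_real)
  then have "\<exists>c. \<forall>i. v i = axis (c i) 1" by metis
  then show ?thesis using that by blast
qed

lemma Assignments_eq_Basis: "Assignments = Basis"
proof
  show "(Assignments :: (real^('n::finite \<Rightarrow> 'k::finite)) set) \<subseteq> Basis"
    unfolding Assignments_def Basis_vec_real[where 'k = "'n \<Rightarrow> 'k"]
    by (auto elim!: Basis_family simp: kron_vec_axis)
  show "(Basis :: (real^('n::finite \<Rightarrow> 'k::finite)) set) \<subseteq> Assignments"
  proof
    fix x :: "real^('n \<Rightarrow> 'k)" assume "x \<in> Basis"
    then obtain c where "x = axis c 1" by (auto simp: Basis_vec_real)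
    then have "x = kron_vec (\<lambda>i. axis (c i) 1)" by (simp add: kron_vec_axis)
    then show "x \<in> Assignments" unfolding Assignments_def
      by (auto simp: Basis_vec_real)
  qed
qed

lemma factors_kron_vec:
  fixes v :: "'n::finite \<Rightarrow> real^'k::finite"
  assumes "\<forall>i. v i \<in> Basis"
  shows "factors (kron_vec v) = v"
  unfolding factors_def
proof (rule the_equality)
  show "(\<forall>i. v i \<in> Basis) \<and> kron_vec v = kron_vec v" using assms by simp
  fix w :: "'n \<Rightarrow> real^'k"
  assume w: "(\<forall>i. w i \<in> Basis) \<and> kron_vec v = kron_vec w"
  obtain c where c: "v = (\<lambda>i. axis (c i) 1)" using assms by (rule Basis_family)
  from w have "\<forall>i. w i \<in> Basis" by simp
  then obtain d where d: "w = (\<lambda>i. axis (d i) 1)" by (rule Basis_family)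
  from w c d have "axis c (1::real) = axis d 1" by (simp add: kron_vec_axis)
  then show "w = v" by (simp add: c d axis_eq_axis)
qed

definition mat_power :: "real^'a^'a \<Rightarrow> nat \<Rightarrow> real^'a^'a" where
  "mat_power A r = (((**) A) ^^ r) (mat 1)"

definition mat_exp :: "real^'a^'a \<Rightarrow> real^'a^'a" where
  "mat_exp A = (\<Sum>r. (1 / fact r) *\<^sub>R mat_power A r)"

lemma summable_mat_exp:
  fixes A :: "real^'a^'a"
  shows "summable (\<lambda>r. (1 / fact r) *\<^sub>R mat_power A r)"
proof -
  have "linear ((**) A :: real^'a^'a \<Rightarrow> real^'a^'a)"
    by (intro linearI) (simp_all add: matrix_add_ldistrib matrix_scalar_ac scalar_matrix_assoc
        flip: scalar_mult_eq_scaleR)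
  then have "bounded_linear ((**) A :: real^'a^'a \<Rightarrow> real^'a^'a)" by (simp add: linear_conv_bounded_linear)
  then obtain K where K: "0 < K" "\<And>B :: real^'a^'a. norm (A ** B) \<le> norm B * K"
    using bounded_linear.pos_bounded by blast
  have pow: "norm (mat_power A r) \<le> K ^ r * norm (mat 1 :: real^'a^'a)" for r
  proof (induction r)
    case 0
    then show ?case by (simp add: mat_power_def)
  next
    case (Suc r)
    have "norm (mat_power A (Suc r)) \<le> norm (mat_power A r) * K"
      using K(2) by (simp add: mat_power_def)
    also have "\<dots> \<le> (K ^ r * norm (mat 1 :: real^'a^'a)) * K"
      using Suc K(1) by (intro mult_right_mono) auto
    finally show ?case by (simp add: mult_ac)
  qed
  have "summable (\<lambda>r. norm (mat 1 :: real^'a^'a) * (inverse (fact r) * K ^ r))"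
    by (intro summable_mult summable_exp)
  moreover have "norm ((1 / fact r) *\<^sub>R mat_power A r)
      \<le> norm (mat 1 :: real^'a^'a) * (inverse (fact r) * K ^ r)" for r
    using mult_left_mono[OF pow[of r], of "inverse (fact r)"]
    by (simp add: field_simps)
  ultimately show ?thesis by (rule summable_comparison_test'[where N = 0])
qed

definition p_SA :: "(real^('n::finite \<Rightarrow> 'k::finite) \<Rightarrow> real) \<Rightarrow> real \<Rightarrow> real^('n \<Rightarrow> 'k) \<Rightarrow> real" where
  "p_SA E \<beta> \<sigma> = exp (- \<beta> * E \<sigma>) / (\<Sum>\<sigma>'\<in>Assignments. exp (- \<beta> * E \<sigma>'))"

text \<open>The position indicated by the basis vector \<open>axis a 1\<close> is \<open>a\<close>.\<close>

definition H_c :: "(real^('n::finite \<Rightarrow> 'k::finite) \<Rightarrow> real) \<Rightarrow> real^('n \<Rightarrow> 'k)^('n \<Rightarrow> 'k)" where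
  "H_c E = (\<chi> a b. if a = b then E (axis a 1) else 0)"

definition rho :: "real \<Rightarrow> real^'k^'k" where
  "rho \<Gamma> = \<Gamma> *\<^sub>R (mat 1 - (\<chi> a b. 1))"

definition rho_at :: "real \<Rightarrow> 'n::finite \<Rightarrow> real^('n \<Rightarrow> 'k::finite)^('n \<Rightarrow> 'k)" where
  "rho_at \<Gamma> i = kron_mat (\<lambda>j. if j = i then rho \<Gamma> else mat 1)"

definition H_q :: "real \<Rightarrow> real^('n::finite \<Rightarrow> 'k::finite)^('n \<Rightarrow> 'k)" where
  "H_q \<Gamma> = (\<Sum>i\<in>UNIV. rho_at \<Gamma> i)"

definition Ham :: "(real^('n::finite \<Rightarrow> 'k::finite) \<Rightarrow> real) \<Rightarrow> real \<Rightarrow> real^('n \<Rightarrow> 'k)^('n \<Rightarrow> 'k)" where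
  "Ham E \<Gamma> = H_c E + H_q \<Gamma>"

definition p_QA :: "(real^('n::finite \<Rightarrow> 'k::finite) \<Rightarrow> real) \<Rightarrow> real \<Rightarrow> real \<Rightarrow> real^('n \<Rightarrow> 'k) \<Rightarrow> real" where
  "p_QA E \<beta> \<Gamma> \<sigma> =
     \<sigma> \<bullet> (mat_exp (- \<beta> *\<^sub>R Ham E \<Gamma>) *v \<sigma>) /
     (\<Sum>\<sigma>'\<in>Assignments. \<sigma>' \<bullet> (mat_exp (- \<beta> *\<^sub>R Ham E \<Gamma>) *v \<sigma>'))"

definition similarity :: "real^('n::finite \<Rightarrow> 'k::finite) \<Rightarrow> real^('n \<Rightarrow> 'k) \<Rightarrow> real" where
  "similarity \<sigma> \<tau> = (1 / real CARD('n)) * (\<Sum>i\<in>UNIV. of_bool (factors \<sigma> i = factors \<tau> i))"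

definition coupling :: "nat \<Rightarrow> nat \<Rightarrow> nat \<Rightarrow> real \<Rightarrow> real \<Rightarrow> real" where
  "coupling n k m \<beta> \<Gamma> = real n * ln (1 + real k / (exp (real k * \<beta> * \<Gamma> / real m) - 1))"

text \<open>
  An \<open>m\<close>-tuple \<open>(\<sigma>\<^sub>1, \<dots>, \<sigma>\<^sub>m)\<close> is a function on \<open>{1..m}\<close>;
  \<open>j mod m + 1\<close> is the cyclic successor of \<open>j\<close>, which implements \<open>\<sigma>\<^bsub>m+1\<^esub> = \<sigma>\<^sub>1\<close>.
\<close>

definition ST_weight ::
  "(real^('n::finite \<Rightarrow> 'k::finite) \<Rightarrow> real) \<Rightarrow> real \<Rightarrow> real \<Rightarrow> nat \<Rightarrow> (nat \<Rightarrow> real^('n \<Rightarrow> 'k)) \<Rightarrow> real" where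
  "ST_weight E \<beta> \<Gamma> m \<sigma> =
     (\<Prod>j\<in>{1..m}. p_SA E (\<beta> / real m) (\<sigma> j) *
        exp (similarity (\<sigma> j) (\<sigma> (j mod m + 1)) * coupling CARD('n) CARD('k) m \<beta> \<Gamma>))"

definition p_QA_ST ::
  "(real^('n::finite \<Rightarrow> 'k::finite) \<Rightarrow> real) \<Rightarrow> real \<Rightarrow> real \<Rightarrow> nat \<Rightarrow> (nat \<Rightarrow> real^('n \<Rightarrow> 'k)) \<Rightarrow> real" where
  "p_QA_ST E \<beta> \<Gamma> m \<sigma> =
     ST_weight E \<beta> \<Gamma> m \<sigma> / (\<Sum>\<tau>\<in>{1..m} \<rightarrow>\<^sub>E Assignments. ST_weight E \<beta> \<Gamma> m \<tau>)"

end

theory Submission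
  imports Defs "HOL-Real_Asymp.Real_Asymp"
begin

text \<open>
  Up to a scalar factor, the weight of one time slice of the classical model is the matrix entry
  \<open>T\<^sub>m(\<sigma>\<^sub>j, \<sigma>\<^sub>j\<^sub>+\<^sub>1)\<close> of \<open>T\<^sub>m = exp (-\<beta> H\<^sub>c / m) exp (-\<beta> H\<^sub>q / m)\<close>, so summing over closed paths
  through \<open>\<sigma>\<^sub>1\<close> gives a diagonal entry of \<open>T\<^sub>m\<^sup>m\<close>, and normalisation cancels the scalar. Since
  \<open>T\<^sub>m = 1 - \<beta> H / m + O(1/m\<^sup>2)\<close> entrywise, telescoping gives
  \<open>T\<^sub>m\<^sup>m = (1 - \<beta> H / m)\<^sup>m + O(1/m)\<close>, and comparing the binomial expansion with the
  exponential series gives \<open>(1 - \<beta> H / m)\<^sup>m = exp (-\<beta> H) + O(1/m)\<close>. The quotient is controlled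
  because the diagonal entries of \<open>T\<^sub>m\<^sup>m\<close> stay above a positive constant.
\<close>

section \<open>Powers of matrices and the operator norm\<close>

lemma mat_power_0 [simp]: "mat_power A 0 = mat 1"
  by (simp add: mat_power_def)

lemma mat_power_Suc: "mat_power A (Suc r) = A ** mat_power A r"
  by (simp add: mat_power_def)

lemma mat_power_Suc_right: "mat_power A (Suc r) = mat_power A r ** A"
  by (induction r) (simp_all add: mat_power_Suc matrix_mul_assoc)

lemma matrix_add_rdistrib:
  fixes A :: "real^'n^'m"
  shows "(A + B) ** C = A ** C + B ** C"
  by (vector matrix_matrix_mult_def sum.distrib[symmetric] field_simps)

lemma matrix_diff_ldistrib:
  fixes A :: "real^'n^'m"
  shows "A ** (B - C) = A ** B - A ** C"
  by (vector matrix_matrix_mult_def sum_subtractf[symmetric] field_simps)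

lemma matrix_diff_rdistrib:
  fixes A :: "real^'n^'m"
  shows "(A - B) ** C = A ** C - B ** C"
  by (vector matrix_matrix_mult_def sum_subtractf[symmetric] field_simps)

text \<open>The \<open>norm\<close> of the type is the Frobenius norm, which gives the identity the
  square root of the dimension. The operator norm gives it at most 1 and is submultiplicative, so
  powers are bounded without a dimension factor.\<close>

definition mnorm :: "real^'n^'m \<Rightarrow> real" where
  "mnorm A = onorm ((*v) A)"

lemma mnorm_nonneg: "0 \<le> mnorm (A :: real^'n^'m)"
  by (simp add: mnorm_def onorm_pos_le)

lemma mnorm_mult: "mnorm (A ** B) \<le> mnorm A * mnorm (B :: real^'n^'m)"
proof -
  have "(*v) (A ** B) = (*v) A \<circ> (*v) B"
    by (simp add: fun_eq_iff matrix_vector_mul_assoc)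
  then show ?thesis
    by (simp add: mnorm_def onorm_compose)
qed

lemma mnorm_add: "mnorm (A + B) \<le> mnorm A + mnorm (B :: real^'n^'m)"
proof -
  have "(*v) (A + B) = (\<lambda>x. A *v x + B *v x)"
    by (simp add: fun_eq_iff matrix_vector_mult_add_rdistrib)
  then show ?thesis
    by (simp add: mnorm_def onorm_triangle)
qed

lemma mnorm_scaleR: "mnorm (c *\<^sub>R A) = \<bar>c\<bar> * mnorm (A :: real^'n^'m)"
proof -
  have "(*v) (c *\<^sub>R A) = (\<lambda>x. c *\<^sub>R (A *v x))"
    by (simp add: fun_eq_iff scaleR_matrix_vector_assoc)
  then show ?thesis
    by (simp add: mnorm_def onorm_scaleR)
qed

lemma mnorm_mat_1: "mnorm (mat 1 :: real^'n^'n) \<le> 1"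
  unfolding mnorm_def by (rule onorm_le) simp

lemma mnorm_zero [simp]: "mnorm 0 = 0"
  using mnorm_scaleR[of 0 0] by simp

lemma component_le_mnorm: "\<bar>A $ i $ j\<bar> \<le> mnorm (A :: real^'n^'m)"
  by (simp add: mnorm_def matrix_component_le_onorm)

lemma mnorm_le_component_sum: "mnorm A \<le> (\<Sum>i\<in>UNIV. \<Sum>j\<in>UNIV. \<bar>(A :: real^'n^'m) $ i $ j\<bar>)"
  by (simp add: mnorm_def onorm_le_matrix_component_sum)

lemma mnorm_mat_power: "mnorm (mat_power A r) \<le> mnorm A ^ r"
proof (induction r)
  case (Suc r)
  have "mnorm (mat_power A (Suc r)) \<le> mnorm A * mnorm (mat_power A r)"
    by (simp add: mat_power_Suc mnorm_mult)
  also have "\<dots> \<le> mnorm A * mnorm A ^ r"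
    using Suc by (intro mult_left_mono mnorm_nonneg)
  finally show ?case by simp
qed (simp add: mnorm_mat_1)

text \<open>Telescoping: A^(r+1) - B^(r+1) = A (A^r - B^r) + (A - B) B^r, with every remaining
  factor bounded by \<open>L\<close>.\<close>

lemma mnorm_power_diff:
  fixes A B :: "real^'n^'n"
  assumes "mnorm A \<le> L" "mnorm B \<le> L" "1 \<le> L" "mnorm (A - B) \<le> d"
  shows "mnorm (mat_power A r - mat_power B r) \<le> real r * L ^ r * d"
proof (induction r)
  case 0
  show ?case by simp
next
  case (Suc r)
  have d: "0 \<le> d" using assms(4) mnorm_nonneg[of "A - B"] by linarith
  have Br: "mnorm (mat_power B r) \<le> L ^ r"
    using mnorm_mat_power[of B r] power_mono[OF assms(2) mnorm_nonneg, of r] by linarith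
  have "mat_power A (Suc r) - mat_power B (Suc r)
      = A ** (mat_power A r - mat_power B r) + (A - B) ** mat_power B r"
    by (simp add: mat_power_Suc matrix_diff_ldistrib matrix_diff_rdistrib)
  then have "mnorm (mat_power A (Suc r) - mat_power B (Suc r))
      \<le> mnorm (A ** (mat_power A r - mat_power B r)) + mnorm ((A - B) ** mat_power B r)"
    by (simp add: mnorm_add)
  also have "\<dots> \<le> mnorm A * mnorm (mat_power A r - mat_power B r)
      + mnorm (A - B) * mnorm (mat_power B r)"
    by (intro add_mono mnorm_mult)
  also have "\<dots> \<le> L * (real r * L ^ r * d) + d * L ^ r"
    using Suc assms d Br by (intro add_mono mult_mono mnorm_nonneg) auto
  \<comment> \<open>Since 1 \<le> \<open>L\<close>, the second summand can be raised to the power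
    \<open>Suc r\<close> of the first; this avoids the exponent r - 1 in the bound.\<close>
  also have "\<dots> \<le> L * (real r * L ^ r * d) + d * (L * L ^ r)"
    using d assms(3) by (intro add_left_mono mult_left_mono) (simp_all add: mult_le_cancel_right1)
  finally show ?case by (simp add: algebra_simps)
qed

section \<open>Euler approximation of the matrix exponential\<close>

text \<open>The identity commutes with \<open>C\<close>, so the scalar binomial theorem carries
  over; the induction step is Pascal's rule after an index shift.\<close>

lemma mat_power_binomial:
  fixes C :: "real^'n^'n"
  shows "mat_power (mat 1 + h *\<^sub>R C) m = (\<Sum>r\<le>m. (real (m choose r) * h ^ r) *\<^sub>R mat_power C r)"
proof (induction m)
  case (Suc m)
  let ?P = "\<lambda>m r. (real (m choose r) * h ^ r) *\<^sub>R mat_power C r"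
  have "h *\<^sub>R (C ** (\<Sum>r\<le>m. ?P m r)) = (\<Sum>r\<le>m. (real (m choose r) * h ^ Suc r) *\<^sub>R mat_power C (Suc r))"
  proof -
    have "C ** (\<Sum>r\<in>S. ?P m r) = (\<Sum>r\<in>S. C ** ?P m r)" if "finite S" for S
      using that by (induction S) (simp_all add: matrix_add_ldistrib)
    then show ?thesis
      by (simp add: scaleR_sum_right mat_power_Suc matrix_scalar_ac scalar_matrix_assoc mult_ac)
  qed
  then have "mat_power (mat 1 + h *\<^sub>R C) (Suc m)
      = (\<Sum>r\<le>m. ?P m r) + (\<Sum>r\<le>m. (real (m choose r) * h ^ Suc r) *\<^sub>R mat_power C (Suc r))"
    by (simp add: mat_power_Suc[of "mat 1 + h *\<^sub>R C"] matrix_add_rdistrib Suc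
        scalar_matrix_assoc[symmetric])
  also have "(\<Sum>r\<le>m. ?P m r) = (\<Sum>r\<le>Suc m. ?P m r)"
    by simp
  also have "\<dots> = ?P m 0 + (\<Sum>r\<le>m. ?P m (Suc r))"
    by (rule sum.atMost_Suc_shift)
  finally show ?case
    by (simp add: sum.atMost_Suc_shift sum.distrib algebra_simps del: sum.atMost_Suc power_Suc)
qed simp

text \<open>\<open>u\<close> is the product of 1 - i/m over i < r. As the partial products lie
  between 0 and 1, passing from r to r + 1 loses at most r/m, and these losses add up to at most
  r^2/m.\<close>

lemma falling_ratio_bounds:
  fixes m r :: nat
  assumes "m \<ge> 1"
  defines "u \<equiv> fact r * real (m choose r) / real m ^ r"
  shows "u \<le> 1" and "1 - (real r)\<^sup>2 / real m \<le> u"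
proof -
  have "fact r * real (m choose r) / real m ^ r \<le> 1 \<and>
      1 - (real r)\<^sup>2 / real m \<le> fact r * real (m choose r) / real m ^ r"
  proof (induction r)
    case (Suc r)
    let ?u = "\<lambda>r. fact r * real (m choose r) / real m ^ r"
    have m: "real m > 0" using assms(1) by simp
    \<comment> \<open>Stated over the reals, m - r is not truncated, so the recurrence also covers r
      > m.\<close>
    have "real m * real (m choose r) = real r * real (m choose r) + real (Suc r) * real (m choose Suc r)"
      using gbinomial_mult_1[of "real m" r] by (simp add: binomial_gbinomial)
    then have eq: "real (Suc r) * real (m choose Suc r) = (real m - real r) * real (m choose r)"
      by (simp add: algebra_simps)
    have "?u (Suc r) = fact r * (real (Suc r) * real (m choose Suc r)) / (real m * real m ^ r)"
      by (simp add: mult_ac)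
    also have "\<dots> = ?u r - ?u r * (real r / real m)"
      unfolding eq using m by (simp add: field_simps)
    finally have step: "?u (Suc r) = ?u r - ?u r * (real r / real m)" .
    have "0 \<le> ?u r * (real r / real m)" by simp
    moreover have "?u r * (real r / real m) \<le> real r / real m"
      using Suc m by (intro mult_left_le_one_le) auto
    moreover have "(real r)\<^sup>2 / real m + real r / real m \<le> (real (Suc r))\<^sup>2 / real m"
      using m by (simp add: add_divide_distrib[symmetric] divide_right_mono power2_eq_square algebra_simps)
    ultimately show ?case
      using Suc step by linarith
  qed simp
  then show "u \<le> 1" "1 - (real r)\<^sup>2 / real m \<le> u" by (simp_all add: u_def)
qed

lemma mat_exp_nth:
  fixes C :: "real^'n^'n"
  shows "(\<lambda>r. mat_power C r $ a $ b / fact r) sums (mat_exp C $ a $ b)"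
proof -
  have "(\<lambda>r. (1 / fact r) *\<^sub>R mat_power C r) sums mat_exp C"
    unfolding mat_exp_def by (rule summable_sums[OF summable_mat_exp])
  from bounded_linear.sums[OF bounded_linear_compose[OF bounded_linear_vec_nth[of b] bounded_linear_vec_nth[of a]] this]
  show ?thesis by simp
qed

text \<open>Compare coefficients: C^r carries 1/r! in the exponential and u(r)/r! in (1 + C/m)^m,
  where 1 - u(r) is at most r^2/m. The resulting series of errors is dominated by an exponential
  series divided by m.\<close>

lemma mat_exp_euler_bound:
  fixes C :: "real^'n^'n"
  assumes m: "m \<ge> 1"
  shows "\<bar>mat_exp C $ a $ b - mat_power (mat 1 + (1 / real m) *\<^sub>R C) m $ a $ b\<bar>
    \<le> exp (4 * mnorm C) / real m"
proof -
  define P where "P r = mat_power C r $ a $ b" for r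
  define u where "u r = fact r * real (m choose r) / real m ^ r" for r
  \<comment> \<open>The binomial sum is read as an infinite series, its terms beyond m being 0, so
    that the two series can be subtracted termwise.\<close>
  have "(\<lambda>r. P r / fact r * u r) sums (\<Sum>r\<le>m. P r / fact r * u r)"
    by (rule sums_finite) (auto simp: u_def binomial_eq_0)
  also have "(\<Sum>r\<le>m. P r / fact r * u r) = mat_power (mat 1 + (1 / real m) *\<^sub>R C) m $ a $ b"
    unfolding mat_power_binomial by (simp add: P_def u_def power_divide mult_ac)
  finally have diff: "(\<lambda>r. P r / fact r - P r / fact r * u r) sums
      (mat_exp C $ a $ b - mat_power (mat 1 + (1 / real m) *\<^sub>R C) m $ a $ b)"
    using sums_diff[OF mat_exp_nth[of C a b, folded P_def]] by blast
  have majorant: "(\<lambda>r. (4 * mnorm C) ^ r /\<^sub>R fact r / real m) sums (exp (4 * mnorm C) / real m)"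
    by (intro sums_divide exp_converges)
  have "norm (P r / fact r - P r / fact r * u r) \<le> (4 * mnorm C) ^ r /\<^sub>R fact r / real m" for r
  proof -
    have "\<bar>P r\<bar> \<le> mnorm C ^ r"
      unfolding P_def using component_le_mnorm mnorm_mat_power order_trans by blast
    \<comment> \<open>The crude bound r^2 \<le> 4^r absorbs the polynomial factor into the series;
      this is where the 4 in \<open>exp (4 * mnorm C)\<close> comes from.\<close>
    moreover have "\<bar>1 - u r\<bar> \<le> 4 ^ r / real m"
    proof -
      have "real r \<le> 2 ^ r"
        by (rule less_imp_le) (rule of_nat_less_two_power)
      then have "(real r)\<^sup>2 \<le> (2 ^ r)\<^sup>2"
        by (rule power_mono) simp
      then have "(real r)\<^sup>2 / real m \<le> 4 ^ r / real m"
        by (intro divide_right_mono) (simp_all add: power2_eq_square power_mult_distrib[symmetric])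
      then show ?thesis
        using falling_ratio_bounds[OF m, of r] by (simp add: u_def)
    qed
    ultimately have "\<bar>P r\<bar> * \<bar>1 - u r\<bar> \<le> mnorm C ^ r * (4 ^ r / real m)"
      by (intro mult_mono) (auto simp: mnorm_nonneg)
    then have "\<bar>P r\<bar> * \<bar>1 - u r\<bar> / fact r \<le> mnorm C ^ r * (4 ^ r / real m) / fact r"
      by (rule divide_right_mono) simp
    moreover have "P r / fact r - P r / fact r * u r = P r * (1 - u r) / fact r"
      by (simp add: field_simps)
    ultimately show ?thesis
      by (simp add: abs_mult power_mult_distrib divide_inverse mult_ac)
  qed
  from norm_sums_le[OF diff majorant this] show ?thesis by simp
qed

section \<open>First-order expansions in 1/m\<close>

text \<open>The precision is chosen for m-fold products: an error O(1/m^2) per factor accumulates to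
  O(1/m).\<close>

definition first_order_jet :: "(nat \<Rightarrow> real) \<Rightarrow> real \<Rightarrow> real \<Rightarrow> bool" where
  "first_order_jet f a b \<longleftrightarrow> (\<lambda>m. f m - (a + b / real m)) \<in> O(\<lambda>m. 1 / real m ^ 2)"

lemma first_order_jet_const [simp]: "first_order_jet (\<lambda>_. a) a 0"
  by (simp add: first_order_jet_def)

lemma first_order_jet_exp: "first_order_jet (\<lambda>m. exp (c / real m)) 1 c"
  unfolding first_order_jet_def by real_asymp

lemma first_order_jet_add:
  assumes "first_order_jet f a b" "first_order_jet g a' b'"
  shows "first_order_jet (\<lambda>m. f m + g m) (a + a') (b + b')"
  using sum_in_bigo(1)[OF assms[unfolded first_order_jet_def]]
  by (simp add: first_order_jet_def add_divide_distrib algebra_simps)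

text \<open>Leibniz rule. Besides the products containing a remainder \<open>F\<close> or
  \<open>G\<close>, only b b'/m^2 is left over, and it is already of the order of the error.\<close>

lemma first_order_jet_mult:
  assumes "first_order_jet f a b" "first_order_jet g a' b'"
  shows "first_order_jet (\<lambda>m. f m * g m) (a * a') (a * b' + b * a')"
proof -
  define F where "F m = f m - (a + b / real m)" for m
  define G where "G m = g m - (a' + b' / real m)" for m
  have F: "F \<in> O(\<lambda>m. 1 / real m ^ 2)" and G: "G \<in> O(\<lambda>m. 1 / real m ^ 2)"
    using assms unfolding first_order_jet_def F_def G_def by blast+
  have lin: "(\<lambda>m. x + y / real m) \<in> O(\<lambda>_. 1)" for x y
    by real_asymp
  have sq1: "(\<lambda>m. 1 / real m ^ 2) \<in> O(\<lambda>_. 1)"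
    by real_asymp
  have "(\<lambda>m. F m * (a' + b' / real m)) \<in> O(\<lambda>m. 1 / real m ^ 2)"
    using landau_o.big.mult[OF F lin] by simp
  moreover have "(\<lambda>m. F m * G m) \<in> O(\<lambda>m. 1 / real m ^ 2)"
    using landau_o.big.mult[OF F landau_o.big_trans[OF G sq1]] by simp
  moreover have "(\<lambda>m. (a + b / real m) * G m) \<in> O(\<lambda>m. 1 / real m ^ 2)"
    using landau_o.big.mult[OF lin G] by simp
  moreover have "(\<lambda>m. b * b' * (1 / real m ^ 2)) \<in> O(\<lambda>m. 1 / real m ^ 2)"
    by (rule bigoI[of _ "\<bar>b * b'\<bar>"]) (simp add: abs_mult)
  ultimately have "(\<lambda>m. F m * (a' + b' / real m) + F m * G m + (a + b / real m) * G m
      + b * b' * (1 / real m ^ 2)) \<in> O(\<lambda>m. 1 / real m ^ 2)"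
    by (intro sum_in_bigo)
  moreover have "F m * (a' + b' / real m) + F m * G m + (a + b / real m) * G m
      + b * b' * (1 / real m ^ 2) = f m * g m - (a * a' + (a * b' + b * a') / real m)" for m
    by (simp add: F_def G_def algebra_simps add_divide_distrib power2_eq_square)
  ultimately show ?thesis
    by (simp add: first_order_jet_def)
qed

lemma first_order_jet_cmult:
  assumes "first_order_jet f a b"
  shows "first_order_jet (\<lambda>m. c * f m) (c * a) (c * b)"
  using first_order_jet_mult[OF first_order_jet_const[of c] assms] by simp

text \<open>Leibniz rule for many factors. The slope is a sum of products with one factor replaced,
  the same shape as an entry of \<open>H_q\<close>, where \<open>rho\<close> sits at one site and
  identities elsewhere.\<close>

lemma first_order_jet_prod:
  assumes "finite I" "\<And>i. i \<in> I \<Longrightarrow> first_order_jet (f i) (a i) (b i)"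
  shows "first_order_jet (\<lambda>m. \<Prod>i\<in>I. f i m) (\<Prod>i\<in>I. a i)
    (\<Sum>i\<in>I. \<Prod>j\<in>I. if j = i then b j else a j)"
  using assms
proof (induction I rule: finite_induct)
  case (insert x I)
  have "(\<Sum>i\<in>insert x I. \<Prod>j\<in>insert x I. if j = i then b j else a j)
      = a x * (\<Sum>i\<in>I. \<Prod>j\<in>I. if j = i then b j else a j) + b x * (\<Prod>i\<in>I. a i)"
  proof -
    have "(\<Prod>j\<in>I. if j = x then b j else a j) = (\<Prod>i\<in>I. a i)"
      using insert.hyps by (intro prod.cong) auto
    moreover have "(\<Sum>i\<in>I. \<Prod>j\<in>insert x I. if j = i then b j else a j)
        = (\<Sum>i\<in>I. a x * (\<Prod>j\<in>I. if j = i then b j else a j))"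
      using insert.hyps by (intro sum.cong) auto
    ultimately show ?thesis
      using insert.hyps by (simp add: sum_distrib_left)
  qed
  then show ?case
    using first_order_jet_mult[of "f x" "a x" "b x"] insert by simp
qed simp

section \<open>Convergence of powers and of quotients\<close>

text \<open>The Euler step \<open>S m\<close> = 1 + C/m mediates. Its m-th power is within O(1/m) of
  the exponential, and replacing it by \<open>T m\<close> changes each of the m factors by O(1/m^2),
  while products of the factors stay bounded.\<close>

theorem mat_power_jet_limit:
  fixes T :: "nat \<Rightarrow> real^'n^'n"
  assumes jet: "\<And>a b. first_order_jet (\<lambda>m. T m $ a $ b) (mat 1 $ a $ b) (C $ a $ b)"
  shows "(\<lambda>m. mat_exp C $ a $ b - mat_power (T m) m $ a $ b) \<in> O(\<lambda>m. 1 / real m)"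
proof -
  define S where "S m = mat 1 + (1 / real m) *\<^sub>R C" for m :: nat
  \<comment> \<open>There are finitely many entries, so the entrywise estimates yield one for the
    entry sum, which dominates the operator norm.\<close>
  have "(\<lambda>m. \<Sum>i\<in>UNIV. \<Sum>j\<in>UNIV. \<bar>(T m - S m) $ i $ j\<bar>) \<in> O(\<lambda>m. 1 / real m ^ 2)"
  proof (intro big_sum_in_bigo)
    fix i j
    show "(\<lambda>m. \<bar>(T m - S m) $ i $ j\<bar>) \<in> O(\<lambda>m. 1 / real m ^ 2)"
      using jet[of i j] by (simp add: first_order_jet_def S_def)
  qed
  then obtain K where K: "K > 0" "\<forall>\<^sub>F m in at_top.
      norm (\<Sum>i\<in>UNIV. \<Sum>j\<in>UNIV. \<bar>(T m - S m) $ i $ j\<bar>) \<le> K * norm (1 / real m ^ 2)"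
    by (elim landau_o.bigE)
  \<comment> \<open>\<open>mnorm C\<close> accounts for the Euler step and \<open>K\<close> for the
    deviation, as K/m^2 \<le> K/m; thus 1 + M/m bounds the norms of both \<open>T m\<close> and
    \<open>S m\<close>.\<close>
  define M where "M = mnorm C + K"
  define D where "D = exp (4 * mnorm C) + exp M * K"
  have "\<forall>\<^sub>F m in at_top. \<bar>mat_exp C $ a $ b - mat_power (T m) m $ a $ b\<bar> \<le> D * (1 / real m)"
    using K(2) eventually_ge_at_top[of 1]
  proof eventually_elim
    case (elim m)
    then have m: "real m \<ge> 1" by simp
    have "mnorm (T m - S m) \<le> \<bar>\<Sum>i\<in>UNIV. \<Sum>j\<in>UNIV. \<bar>(T m - S m) $ i $ j\<bar>\<bar>"
      using mnorm_le_component_sum[of "T m - S m"] by linarith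
    also have "\<dots> \<le> K / real m ^ 2"
      using elim(1) by (simp only: real_norm_def) simp
    finally have d: "mnorm (T m - S m) \<le> K / real m ^ 2" .
    have KK: "K / real m ^ 2 \<le> K / real m"
      using m K(1) by (intro divide_left_mono) (simp_all add: power2_eq_square)
    have S: "mnorm (S m) \<le> 1 + mnorm C / real m"
      unfolding S_def using mnorm_add[of "mat 1" "(1 / real m) *\<^sub>R C"] mnorm_mat_1[where 'n = 'n]
      by (simp add: mnorm_scaleR)
    have Tm: "mnorm (T m) \<le> mnorm (S m) + mnorm (T m - S m)"
      using mnorm_add[of "S m" "T m - S m"] by simp
    have L: "mnorm (T m) \<le> 1 + M / real m" "mnorm (S m) \<le> 1 + M / real m"
    proof -
      have "0 \<le> K / real m" using K(1) by simp
      then show "mnorm (T m) \<le> 1 + M / real m" "mnorm (S m) \<le> 1 + M / real m"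
        using d S KK Tm
        unfolding M_def add_divide_distrib by linarith+
    qed
    have M: "0 \<le> M" using K(1) mnorm_nonneg[of C] by (simp add: M_def)
    have "mnorm (mat_power (T m) m - mat_power (S m) m) \<le> real m * (1 + M / real m) ^ m * (K / real m ^ 2)"
      using mnorm_power_diff[OF L _ d] M by simp
    \<comment> \<open>(1 + M/m)^m \<le> exp M uniformly in m, so one power of m cancels and K/m
      remains up to a constant.\<close>
    also have "\<dots> \<le> real m * exp M * (K / real m ^ 2)"
      using exp_ge_one_plus_x_over_n_power_n[of m M] M m K(1)
      by (intro mult_right_mono mult_left_mono) auto
    also have "\<dots> = exp M * K / real m"
      using m by (simp add: power2_eq_square)
    finally have "\<bar>(mat_power (T m) m - mat_power (S m) m) $ a $ b\<bar> \<le> exp M * K / real m"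
      using component_le_mnorm order_trans by blast
    moreover have "\<bar>mat_exp C $ a $ b - mat_power (S m) m $ a $ b\<bar> \<le> exp (4 * mnorm C) / real m"
      unfolding S_def by (rule mat_exp_euler_bound) (use elim in simp)
    ultimately show ?case
      by (simp add: D_def add_divide_distrib)
  qed
  then show ?thesis
    by (intro bigoI[of _ D]) (simp add: eventually_mono)
qed

text \<open>x0/z0 - x/z = ((x0 - x) - (x0/z0) (z0 - z)) / z, and the lower bound \<open>c\<close>
  keeps 1/z bounded.\<close>

lemma bigo_quotient:
  fixes x z :: "nat \<Rightarrow> real"
  assumes "(\<lambda>m. x0 - x m) \<in> O(\<lambda>m. 1 / real m)" "(\<lambda>m. z0 - z m) \<in> O(\<lambda>m. 1 / real m)"
    and "\<forall>\<^sub>F m in at_top. c \<le> z m" "c > 0" "z0 \<noteq> 0"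
  shows "(\<lambda>m. x0 / z0 - x m / z m) \<in> O(\<lambda>m. 1 / real m)"
proof -
  have inv: "(\<lambda>m. 1 / z m) \<in> O(\<lambda>_. 1)"
    using assms(3)
    by (intro bigoI[of _ "1 / c"], eventually_elim) (use assms(4) in \<open>auto simp: frac_le\<close>)
  have "(\<lambda>m. ((x0 - x m) - x0 / z0 * (z0 - z m)) * (1 / z m)) \<in> O(\<lambda>m. 1 / real m * 1)"
  proof (intro landau_o.big.mult inv sum_in_bigo(2)[OF assms(1)])
    have "(\<lambda>m. x0 / z0 * (z0 - z m)) \<in> O(\<lambda>m. x0 / z0 * (1 / real m))"
      by (rule landau_o.big.mult_left[OF assms(2)])
    also have "(\<lambda>m. x0 / z0 * (1 / real m)) \<in> O(\<lambda>m. 1 / real m)"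
      by (rule bigoI[of _ "\<bar>x0 / z0\<bar>"]) (simp add: abs_mult)
    finally show "(\<lambda>m. x0 / z0 * (z0 - z m)) \<in> O(\<lambda>m. 1 / real m)" .
  qed
  moreover have "\<forall>\<^sub>F m in at_top. ((x0 - x m) - x0 / z0 * (z0 - z m)) * (1 / z m) = x0 / z0 - x m / z m"
    using assms(3) by eventually_elim (use assms(4,5) in \<open>simp add: field_simps\<close>)
  ultimately show ?thesis
    by (simp add: landau_o.big.in_cong)
qed

section \<open>Matrix powers as sums over paths\<close>

text \<open>An entry of a power sums the weights of all walks from a to b. Position 1 is pinned to
  \<open>e a\<close> and the final step leads to \<open>e b\<close>. The endpoint b is kept
  independent of a, because the induction removes the last free vertex c and needs the walks ending
  at c.\<close>

lemma mat_power_path_sum: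
  fixes A :: "real^'a^'a" and e :: "'a \<Rightarrow> 'v"
  assumes "inj e" "\<And>a b. K (e a) (e b) = A $ a $ b"
  shows "(\<Sum>\<sigma>\<in>{2..Suc m} \<rightarrow>\<^sub>E range e.
      (\<Prod>j\<in>{1..m}. K ((\<sigma>(1 := e a)) j) ((\<sigma>(1 := e a)) (Suc j))) * K ((\<sigma>(1 := e a)) (Suc m)) (e b))
    = mat_power A (Suc m) $ a $ b"
proof (induction m arbitrary: b)
  case 0
  show ?case by (simp add: assms mat_power_Suc)
next
  case (Suc m)
  let ?P = "\<lambda>\<sigma> m. \<Prod>j\<in>{1..m}. K ((\<sigma>(1 := e a)) j) ((\<sigma>(1 := e a)) (Suc j))"
  let ?N = "Suc (Suc m)"
  have "{2..?N} = insert ?N {2..Suc m}" by auto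
  then have "(\<Sum>\<sigma>\<in>{2..?N} \<rightarrow>\<^sub>E range e. ?P \<sigma> (Suc m) * K ((\<sigma>(1 := e a)) ?N) (e b))
      = (\<Sum>(y, \<sigma>)\<in>range e \<times> ({2..Suc m} \<rightarrow>\<^sub>E range e).
          ?P (\<sigma>(?N := y)) (Suc m) * K (((\<sigma>(?N := y))(1 := e a)) ?N) (e b))"
    using inj_combinator[of ?N "{2..Suc m}" "\<lambda>_. range e"]
    by (simp only: PiE_insert_eq) (subst sum.reindex, auto simp: case_prod_unfold)
  also have "\<dots> = (\<Sum>(y, \<sigma>)\<in>range e \<times> ({2..Suc m} \<rightarrow>\<^sub>E range e).
          ?P \<sigma> m * K ((\<sigma>(1 := e a)) (Suc m)) y * K y (e b))"
  proof (intro sum.cong refl, clarify)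
    fix \<sigma> :: "nat \<Rightarrow> 'v" and y
    \<comment> \<open>The product up to m reads only positions up to m + 1, while \<open>?N\<close>
      is m + 2.\<close>
    have "?P (\<sigma>(?N := e y)) m = ?P \<sigma> m"
      by (intro prod.cong) auto
    then show "?P (\<sigma>(?N := e y)) (Suc m) * K (((\<sigma>(?N := e y))(1 := e a)) ?N) (e b)
        = ?P \<sigma> m * K ((\<sigma>(1 := e a)) (Suc m)) (e y) * K (e y) (e b)"
      by simp
  qed
  also have "\<dots> = (\<Sum>c\<in>UNIV. (\<Sum>\<sigma>\<in>{2..Suc m} \<rightarrow>\<^sub>E range e.
      ?P \<sigma> m * K ((\<sigma>(1 := e a)) (Suc m)) (e c)) * K (e c) (e b))"
    by (simp add: sum.cartesian_product[symmetric] sum.reindex[OF assms(1)] sum_distrib_right)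
  also have "\<dots> = mat_power A ?N $ a $ b"
    unfolding Suc.IH assms(2) by (simp add: mat_power_Suc_right[of A "Suc m"] matrix_matrix_mult_def)
  finally show ?case by simp
qed

lemma mat_power_nonneg:
  fixes A :: "real^'a^'a"
  assumes "\<And>a b. 0 \<le> A $ a $ b"
  shows "0 \<le> mat_power A r $ a $ b"
  by (induction r arbitrary: a b) (auto simp: mat_def mat_power_Suc matrix_matrix_mult_def assms intro!: sum_nonneg)

text \<open>With nonnegative weights, the closed walk that stays at a is one of the
  summands.\<close>

lemma mat_power_diagonal_ge:
  fixes A :: "real^'a^'a"
  assumes "\<And>a b. 0 \<le> A $ a $ b"
  shows "(A $ a $ a) ^ r \<le> mat_power A r $ a $ a"
proof (induction r)
  case (Suc r)
  have "(A $ a $ a) ^ Suc r \<le> A $ a $ a * mat_power A r $ a $ a"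
    using Suc assms by (simp add: mult_left_mono)
  also have "\<dots> \<le> (\<Sum>c\<in>UNIV. A $ a $ c * mat_power A r $ c $ a)"
    by (rule member_le_sum) (auto simp: assms mat_power_nonneg)
  finally show ?case
    by (simp add: mat_power_Suc matrix_matrix_mult_def)
qed (simp add: mat_def)

lemma mat_power_scaleR: "mat_power (c *\<^sub>R A) r = c ^ r *\<^sub>R mat_power A r"
proof (induction r)
  case (Suc r)
  have "mat_power (c *\<^sub>R A) (Suc r) = (c *\<^sub>R A) ** (c ^ r *\<^sub>R mat_power A r)"
    by (simp add: mat_power_Suc Suc)
  also have "\<dots> = c *\<^sub>R (c ^ r *\<^sub>R (A ** mat_power A r))"
    by (simp only: matrix_scalar_ac scalar_matrix_assoc[symmetric] scaleR_scaleR mult.commute)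
  finally show ?case by (simp add: mat_power_Suc)
qed simp

section \<open>The one-step Trotter matrix and its expansion\<close>

text \<open>
  \<open>site_mat t\<close> is \<open>exp (-t (1 - J))\<close> for the all-ones matrix \<open>J\<close>: as \<open>J\<^sup>2 = k J\<close>, one has
  \<open>exp (t J) = 1 + ((exp (k t) - 1) / k) J\<close>.
\<close>

definition site_mat :: "real \<Rightarrow> real^'k^'k" where
  "site_mat t = (\<chi> x y. exp (- t) * (of_bool (x = y) + (exp (real CARD('k) * t) - 1) / real CARD('k)))"

text \<open>The diagonal factor from \<open>H_c\<close> scales row a. The matrices
  \<open>rho_at\<close> commute and act on different sites, so the exponential of their sum is a
  Kronecker power of \<open>site_mat\<close>.\<close>

definition trotter_mat ::
  "(real^('n::finite \<Rightarrow> 'k::finite) \<Rightarrow> real) \<Rightarrow> real \<Rightarrow> real \<Rightarrow> nat \<Rightarrow> real^('n \<Rightarrow> 'k)^('n \<Rightarrow> 'k)" where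
  "trotter_mat E \<beta> \<Gamma> m = (\<chi> a b. exp (- \<beta> * E (axis a 1) / real m) *
     kron_mat (\<lambda>_. site_mat (\<beta> * \<Gamma> / real m)) $ a $ b)"

lemma first_order_jet_site_mat:
  "first_order_jet (\<lambda>m. site_mat (\<beta> * \<Gamma> / real m) $ x $ y)
     ((mat 1 :: real^'k^'k) $ x $ y) (- \<beta> * (rho \<Gamma> :: real^'k::finite^'k) $ x $ y)"
proof -
  let ?k = "real CARD('k)"
  \<comment> \<open>Separating -1/k leaves two pure exponentials in 1/m, whose jets are
    known.\<close>
  have "first_order_jet (\<lambda>m. exp (- (\<beta> * \<Gamma>) / real m) *
      ((of_bool (x = y) + - (1 / ?k)) + 1 / ?k * exp (?k * (\<beta> * \<Gamma>) / real m)))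
      (1 * ((of_bool (x = y) + - (1 / ?k)) + 1 / ?k * 1))
      (1 * (0 + 1 / ?k * (?k * (\<beta> * \<Gamma>))) + - (\<beta> * \<Gamma>) * ((of_bool (x = y) + - (1 / ?k)) + 1 / ?k * 1))"
    by (intro first_order_jet_mult first_order_jet_exp first_order_jet_add first_order_jet_const first_order_jet_cmult)
  moreover have "(mat 1 :: real^'k^'k) $ x $ y = of_bool (x = y)"
    by (simp add: mat_def)
  moreover have "- \<beta> * (rho \<Gamma> :: real^'k^'k) $ x $ y = \<beta> * \<Gamma> - \<beta> * \<Gamma> * of_bool (x = y)"
    by (simp add: rho_def mat_def algebra_simps)
  ultimately show ?thesis
    by (simp add: site_mat_def diff_divide_distrib algebra_simps)
qed

lemma kron_mat_mat_1: "kron_mat (\<lambda>_. mat 1) = (mat 1 :: real^('n::finite \<Rightarrow> 'k::finite)^('n \<Rightarrow> 'k))"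
  unfolding vec_eq_iff
proof (intro allI)
  fix a b :: "'n \<Rightarrow> 'k"
  show "kron_mat (\<lambda>_. mat 1) $ a $ b = (mat 1 :: real^('n \<Rightarrow> 'k)^('n \<Rightarrow> 'k)) $ a $ b"
  proof (cases "a = b")
    case False
    then obtain i where "a i \<noteq> b i" by blast
    with False show ?thesis by (auto simp: kron_mat_def mat_def)
  qed (simp add: kron_mat_def mat_def)
qed

text \<open>To first order the product of the two exponentials only adds their slopes: the row
  factor contributes \<open>H_c\<close>, the Leibniz rule over the sites contributes
  \<open>H_q\<close>. Noncommutativity enters only at order 1/m^2.\<close>

lemma first_order_jet_trotter_mat:
  fixes E :: "real^('n::finite \<Rightarrow> 'k::finite) \<Rightarrow> real"
  shows "first_order_jet (\<lambda>m. trotter_mat E \<beta> \<Gamma> m $ a $ b)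
    (mat 1 $ a $ b) ((- \<beta> *\<^sub>R Ham E \<Gamma>) $ a $ b)"
proof -
  define I where "I = (mat 1 :: real^('n \<Rightarrow> 'k)^('n \<Rightarrow> 'k)) $ a $ b"
  define r s where "r j = (rho \<Gamma> :: real^'k^'k) $ a j $ b j" and "s j = (mat 1 :: real^'k^'k) $ a j $ b j" for j
  \<comment> \<open>The factor -\<beta> sits at the one replaced site and therefore comes out of the
    product exactly once.\<close>
  have "(\<Prod>j\<in>UNIV. if j = i then - \<beta> * r j else s j) = - \<beta> * (\<Prod>j\<in>UNIV. if j = i then r j else s j)" for i
  proof -
    have "(\<Prod>j\<in>UNIV. if j = i then - \<beta> * r j else s j)
        = (\<Prod>j\<in>UNIV. (if j = i then - \<beta> else 1) * (if j = i then r j else s j))"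
      by (intro prod.cong) auto
    then show ?thesis
      by (simp add: prod.distrib)
  qed
  moreover have "rho_at \<Gamma> i $ a $ b = (\<Prod>j\<in>UNIV. if j = i then r j else s j)" for i
    by (auto simp: rho_at_def kron_mat_def r_def s_def intro!: prod.cong)
  ultimately have "(\<Sum>i\<in>UNIV. \<Prod>j\<in>UNIV. if j = i then - \<beta> * r j else s j) = - \<beta> * H_q \<Gamma> $ a $ b"
    by (simp add: H_q_def sum_distrib_left sum_negf)
  moreover have "(\<Prod>i\<in>UNIV. s i) = I"
    by (simp add: I_def s_def kron_mat_mat_1[symmetric] kron_mat_def)
  moreover have "first_order_jet (\<lambda>m. \<Prod>i\<in>UNIV. site_mat (\<beta> * \<Gamma> / real m) $ a i $ b i)
      (\<Prod>i\<in>UNIV. s i) (\<Sum>i\<in>UNIV. \<Prod>j\<in>UNIV. if j = i then - \<beta> * r j else s j)"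
    unfolding r_def s_def by (intro first_order_jet_prod first_order_jet_site_mat) simp
  ultimately have "first_order_jet (\<lambda>m. \<Prod>i\<in>UNIV. site_mat (\<beta> * \<Gamma> / real m) $ a i $ b i)
      I (- \<beta> * H_q \<Gamma> $ a $ b)"
    by simp
  from first_order_jet_mult[OF first_order_jet_exp[of "- \<beta> * E (axis a 1)"] this]
  have "first_order_jet (\<lambda>m. trotter_mat E \<beta> \<Gamma> m $ a $ b) I
      (- \<beta> * H_q \<Gamma> $ a $ b - \<beta> * E (axis a 1) * I)"
    by (simp add: trotter_mat_def kron_mat_def)
  \<comment> \<open>\<open>I\<close> vanishes off the diagonal, so \<open>E (axis a 1) * I\<close>
    is the entry of \<open>H_c\<close>.\<close>
  moreover have "- \<beta> * H_q \<Gamma> $ a $ b - \<beta> * E (axis a 1) * I = (- \<beta> *\<^sub>R Ham E \<Gamma>) $ a $ b"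
    by (simp add: Ham_def H_c_def I_def mat_def algebra_simps)
  ultimately show ?thesis by (simp add: I_def)
qed

lemma trotter_mat_nonneg:
  assumes "0 \<le> \<beta>" "0 \<le> \<Gamma>"
  shows "0 \<le> trotter_mat E \<beta> \<Gamma> m $ a $ b"
  using assms by (auto simp: trotter_mat_def kron_mat_def site_mat_def intro!: mult_nonneg_nonneg prod_nonneg add_nonneg_nonneg)

text \<open>Each diagonal entry of \<open>site_mat\<close> is at least exp(-t), the other summand
  being nonnegative. The bound has the form exp(-const/m), so its m-th power is independent of
  m.\<close>

lemma trotter_mat_diagonal_ge:
  fixes E :: "real^('n::finite \<Rightarrow> 'k::finite) \<Rightarrow> real"
  assumes "0 \<le> \<beta>" "0 \<le> \<Gamma>"
  shows "exp (- (\<beta> * E (axis a 1) + real CARD('n) * \<beta> * \<Gamma>) / real m) \<le> trotter_mat E \<beta> \<Gamma> m $ a $ a"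
proof -
  let ?t = "\<beta> * \<Gamma> / real m"
  have "exp (- ?t) ^ CARD('n) \<le> (\<Prod>i\<in>(UNIV :: 'n set). site_mat ?t $ a i $ a i)"
    unfolding prod_constant[symmetric]
    by (intro prod_mono) (use assms in \<open>auto simp: site_mat_def\<close>)
  then have "exp (- \<beta> * E (axis a 1) / real m) * exp (- ?t) ^ CARD('n) \<le> trotter_mat E \<beta> \<Gamma> m $ a $ a"
    by (simp add: trotter_mat_def kron_mat_def)
  moreover have "exp (- \<beta> * E (axis a 1) / real m) * exp (- ?t) ^ CARD('n)
      = exp (- (\<beta> * E (axis a 1) + real CARD('n) * \<beta> * \<Gamma>) / real m)"
    by (simp add: exp_of_nat_mult[symmetric] exp_add[symmetric] diff_divide_distrib add_divide_distrib)
  ultimately show ?thesis by simp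
qed

section \<open>Path weights of the classical model\<close>

lemma factors_axis: "factors (axis a 1) = (\<lambda>i. axis (a i) 1)"
  using factors_kron_vec[of "\<lambda>i. axis (a i) 1"] by (simp add: kron_vec_axis Basis_vec_real)

lemma similarity_axis:
  "similarity (axis a 1) (axis b 1 :: real^('n::finite \<Rightarrow> 'k::finite))
    = (\<Sum>i\<in>UNIV. of_bool (a i = b i)) / real CARD('n)"
  by (simp add: similarity_def factors_axis axis_eq_axis)

text \<open>The inverse of the normalization constant of \<open>p_SA\<close> at \<beta>/m times the
  n-th power of the off-diagonal value of \<open>site_mat\<close>.\<close>

definition trotter_scale :: "(real^('n::finite \<Rightarrow> 'k::finite) \<Rightarrow> real) \<Rightarrow> real \<Rightarrow> real \<Rightarrow> nat \<Rightarrow> real" where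
  "trotter_scale E \<beta> \<Gamma> m =
     1 / ((\<Sum>\<sigma>\<in>Assignments. exp (- (\<beta> / real m) * E \<sigma>)) *
       (exp (- (\<beta> * \<Gamma> / real m)) * (exp (real CARD('k) * (\<beta> * \<Gamma> / real m)) - 1) / real CARD('k)) ^ CARD('n))"

text \<open>The n in \<open>coupling\<close> cancels the 1/n in \<open>similarity\<close>, so the
  interaction is q to the number of agreeing sites. The form of the coupling makes q = 1 +
  k/(exp(kt) - 1) the ratio of the diagonal to the off-diagonal value of
  \<open>site_mat\<close>.\<close>

lemma ST_factor_eq_trotter_mat:
  fixes E :: "real^('n::finite \<Rightarrow> 'k::finite) \<Rightarrow> real"
  assumes "\<beta> > 0" "\<Gamma> > 0" "m \<ge> 1"
  shows "p_SA E (\<beta> / real m) (axis a 1) *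
      exp (similarity (axis a 1) (axis b 1 :: real^('n \<Rightarrow> 'k)) * coupling CARD('n) CARD('k) m \<beta> \<Gamma>)
    = (trotter_scale E \<beta> \<Gamma> m *\<^sub>R trotter_mat E \<beta> \<Gamma> m) $ a $ b"
proof -
  define t where "t = \<beta> * \<Gamma> / real m"
  define k where "k = real CARD('k)"
  define w where "w = exp (k * t) - 1"
  define q where "q = 1 + k / w"
  define g where "g = exp (- t) * w / k"
  define Z where "Z = (\<Sum>\<sigma>\<in>(Assignments :: (real^('n \<Rightarrow> 'k)) set). exp (- (\<beta> / real m) * E \<sigma>))"
  have k: "k > 0" by (simp add: k_def)
  have "t > 0" using assms by (simp add: t_def)
  with k have w: "w > 0" by (simp add: w_def)
  have q: "q > 0" using k w by (simp add: q_def add_pos_pos)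
  have g: "g > 0" using k w by (simp add: g_def)
  have "coupling CARD('n) CARD('k) m \<beta> \<Gamma> = real CARD('n) * ln q"
    by (simp add: coupling_def q_def w_def k_def t_def mult_ac)
  then have "exp (similarity (axis a 1) (axis b 1 :: real^('n \<Rightarrow> 'k)) * coupling CARD('n) CARD('k) m \<beta> \<Gamma>)
      = exp (\<Sum>i\<in>UNIV. of_bool (a i = b i) * ln q)"
    by (simp add: similarity_axis sum_distrib_right[symmetric])
  also have "\<dots> = (\<Prod>i\<in>UNIV. if a i = b i then q else 1)"
    unfolding exp_sum[OF finite] using q by (intro prod.cong) auto
  finally have sim: "exp (similarity (axis a 1) (axis b 1 :: real^('n \<Rightarrow> 'k)) *
      coupling CARD('n) CARD('k) m \<beta> \<Gamma>) = (\<Prod>i\<in>UNIV. if a i = b i then q else 1)" .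
  have "(\<Prod>i\<in>UNIV. site_mat t $ a i $ b i) = (\<Prod>i\<in>UNIV. g * (if a i = b i then q else 1))"
    using k w by (intro prod.cong) (auto simp: site_mat_def g_def q_def w_def[symmetric] k_def[symmetric] field_simps)
  also have "\<dots> = g ^ CARD('n) * (\<Prod>i\<in>UNIV. if a i = b i then q else 1)"
    by (simp add: prod.distrib)
  finally have kron: "kron_mat (\<lambda>_. site_mat t) $ a $ b = g ^ CARD('n) * (\<Prod>i\<in>UNIV. if a i = b i then q else 1)"
    by (simp add: kron_mat_def)
  have scale: "trotter_scale E \<beta> \<Gamma> m = 1 / (Z * g ^ CARD('n))"
    by (simp add: trotter_scale_def Z_def g_def w_def k_def t_def)
  show ?thesis
    unfolding sim using g
    by (simp add: scale trotter_mat_def kron p_SA_def t_def[symmetric] Z_def)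
qed

text \<open>The cyclic chain through a fixed first state is a closed walk, so the path sum applies
  with both endpoints equal to a; each of its m steps contributes one scale factor.\<close>

lemma ST_weight_partial_sum:
  fixes E :: "real^('n::finite \<Rightarrow> 'k::finite) \<Rightarrow> real"
  assumes "\<beta> > 0" "\<Gamma> > 0" "m \<ge> 1"
  shows "(\<Sum>\<sigma>\<in>{2..m} \<rightarrow>\<^sub>E Assignments. ST_weight E \<beta> \<Gamma> m (\<sigma>(1 := axis a 1)))
    = trotter_scale E \<beta> \<Gamma> m ^ m * mat_power (trotter_mat E \<beta> \<Gamma> m) m $ a $ a"
proof -
  define e where "e b = (axis b 1 :: real^('n \<Rightarrow> 'k))" for b
  define K where "K u v = p_SA E (\<beta> / real m) u *
      exp (similarity u v * coupling CARD('n) CARD('k) m \<beta> \<Gamma>)" for u v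
  obtain l where l: "m = Suc l" using assms(3) by (cases m) auto
  \<comment> \<open>For j \<le> l the cyclic successor is \<open>Suc j\<close>; at j = m it wraps to
    1, which gives the separate closing factor.\<close>
  have "ST_weight E \<beta> \<Gamma> m \<tau> = (\<Prod>j\<in>{1..l}. K (\<tau> j) (\<tau> (Suc j))) * K (\<tau> (Suc l)) (\<tau> 1)" for \<tau>
    by (simp add: ST_weight_def K_def l)
  moreover have "(Assignments :: (real^('n \<Rightarrow> 'k)) set) = range e"
    by (auto simp: Assignments_eq_Basis Basis_vec_real e_def)
  moreover have "inj e" by (auto simp: inj_def e_def axis_eq_axis)
  moreover have "K (e b) (e c) = (trotter_scale E \<beta> \<Gamma> m *\<^sub>R trotter_mat E \<beta> \<Gamma> m) $ b $ c" for b c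
    unfolding K_def e_def using assms by (rule ST_factor_eq_trotter_mat)
  ultimately show ?thesis
    using mat_power_path_sum[where e = e and K = K and a = a and b = a and m = l
        and A = "trotter_scale E \<beta> \<Gamma> m *\<^sub>R trotter_mat E \<beta> \<Gamma> m"]
    by (simp add: mat_power_scaleR l[symmetric] e_def)
qed

text \<open>Splitting off the first state turns the normalization constant into a trace.\<close>

lemma ST_weight_total_sum:
  fixes E :: "real^('n::finite \<Rightarrow> 'k::finite) \<Rightarrow> real"
  assumes "\<beta> > 0" "\<Gamma> > 0" "m \<ge> 1"
  shows "(\<Sum>\<tau>\<in>{1..m} \<rightarrow>\<^sub>E Assignments. ST_weight E \<beta> \<Gamma> m \<tau>)
    = trotter_scale E \<beta> \<Gamma> m ^ m * (\<Sum>a\<in>UNIV. mat_power (trotter_mat E \<beta> \<Gamma> m) m $ a $ a)"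
proof -
  have "{1..m} = insert 1 {2..m}" using assms(3) by auto
  then have "(\<Sum>\<tau>\<in>{1..m} \<rightarrow>\<^sub>E Assignments. ST_weight E \<beta> \<Gamma> m \<tau>)
      = (\<Sum>(y, \<sigma>)\<in>Assignments \<times> ({2..m} \<rightarrow>\<^sub>E Assignments). ST_weight E \<beta> \<Gamma> m (\<sigma>(1 := y)))"
    using inj_combinator[of 1 "{2..m}" "\<lambda>_. Assignments :: (real^('n \<Rightarrow> 'k)) set"]
    by (simp only: PiE_insert_eq) (subst sum.reindex, auto simp: case_prod_unfold)
  also have "\<dots> = (\<Sum>y\<in>Assignments. \<Sum>\<sigma>\<in>{2..m} \<rightarrow>\<^sub>E Assignments. ST_weight E \<beta> \<Gamma> m (\<sigma>(1 := y)))"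
    by (rule sum.cartesian_product[symmetric])
  also have "\<dots> = (\<Sum>a\<in>UNIV. \<Sum>\<sigma>\<in>{2..m} \<rightarrow>\<^sub>E Assignments. ST_weight E \<beta> \<Gamma> m (\<sigma>(1 := axis a 1)))"
    unfolding Assignments_eq_Basis Basis_vec_real by (subst sum.reindex) (auto simp: inj_def axis_eq_axis)
  finally show ?thesis
    by (simp only: ST_weight_partial_sum[OF assms] sum_distrib_left)
qed

section \<open>Comparison of the two distributions\<close>

lemma axis_inner_matrix_axis: "axis a 1 \<bullet> (M *v axis b 1) = (M :: real^'a^'b) $ a $ b"
  by (simp add: inner_axis' matrix_vector_mult_basis column_def)

theorem theorem4p1:
  fixes E :: "real^('n::finite \<Rightarrow> 'k::finite) \<Rightarrow> real"
    and \<beta> \<Gamma> :: real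
    and \<sigma>\<^sub>1 :: "real^('n \<Rightarrow> 'k)"
  assumes "\<beta> > 0" and "\<Gamma> > 0" and "\<sigma>\<^sub>1 \<in> Assignments"
  shows "(\<lambda>m. p_QA E \<beta> \<Gamma> \<sigma>\<^sub>1 -
            (\<Sum>\<sigma>\<in>{2..m} \<rightarrow>\<^sub>E Assignments. p_QA_ST E \<beta> \<Gamma> m (\<sigma>(1 := \<sigma>\<^sub>1))))
         \<in> O(\<lambda>m. 1 / real m)"
proof -
  obtain a :: "'n \<Rightarrow> 'k" where a: "\<sigma>\<^sub>1 = axis a 1"
    using assms(3) by (auto simp: Assignments_eq_Basis Basis_vec_real)
  define X where "X b = mat_exp (- \<beta> *\<^sub>R Ham E \<Gamma>) $ b $ b" for b
  define x where "x m b = mat_power (trotter_mat E \<beta> \<Gamma> m) m $ b $ b" for m b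
  \<comment> \<open>The m-th power of the lower bound for the diagonal Trotter entries, hence a
    bound uniform in m.\<close>
  define c where "c b = exp (- (\<beta> * E (axis b 1) + real CARD('n) * \<beta> * \<Gamma>))" for b :: "'n \<Rightarrow> 'k"
  have lim: "(\<lambda>m. X b - x m b) \<in> O(\<lambda>m. 1 / real m)" for b
    unfolding X_def x_def by (intro mat_power_jet_limit first_order_jet_trotter_mat)
  have x_ge: "c b \<le> x m b" if "m \<ge> 1" for m b
  proof -
    have "c b = exp (- (\<beta> * E (axis b 1) + real CARD('n) * \<beta> * \<Gamma>) / real m) ^ m"
      using that by (simp add: c_def exp_of_nat_mult[symmetric])
    also have "\<dots> \<le> (trotter_mat E \<beta> \<Gamma> m $ b $ b) ^ m"
      using assms by (intro power_mono trotter_mat_diagonal_ge) auto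
    also have "\<dots> \<le> x m b"
      unfolding x_def using assms by (intro mat_power_diagonal_ge trotter_mat_nonneg) auto
    finally show ?thesis .
  qed
  \<comment> \<open>The uniform bound passes to the limit and makes the quantum normalization
    constant positive.\<close>
  have X_ge: "c b \<le> X b" for b
  proof (rule tendsto_lowerbound)
    have "(\<lambda>m. 1 / real m) \<in> o(\<lambda>_. 1)" by real_asymp
    with lim[of b] have "(\<lambda>m. X b - x m b) \<in> o(\<lambda>_. 1)"
      by (rule landau_o.big_small_trans)
    then have "(\<lambda>m. X b - x m b) \<longlonglongrightarrow> 0"
      by (auto dest: smalloD_tendsto)
    from tendsto_diff[OF tendsto_const[of "X b"] this] show "(\<lambda>m. x m b) \<longlonglongrightarrow> X b"
      by simp
    show "\<forall>\<^sub>F m in sequentially. c b \<le> x m b"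
      using eventually_ge_at_top[of 1] by eventually_elim (rule x_ge)
  qed simp
  have c_pos: "0 < sum c UNIV"
    by (intro sum_pos) (auto simp: c_def)
  have quotient: "(\<lambda>m. X a / sum X UNIV - x m a / sum (x m) UNIV) \<in> O(\<lambda>m. 1 / real m)"
  proof (rule bigo_quotient)
    show "(\<lambda>m. sum X UNIV - sum (x m) UNIV) \<in> O(\<lambda>m. 1 / real m)"
      unfolding sum_subtractf[symmetric] by (intro big_sum_in_bigo lim)
    show "\<forall>\<^sub>F m in at_top. sum c UNIV \<le> sum (x m) UNIV"
      using eventually_ge_at_top[of 1] by eventually_elim (intro sum_mono x_ge)
    have "sum c UNIV \<le> sum X UNIV" by (intro sum_mono X_ge)
    with c_pos show "sum X UNIV \<noteq> 0" by linarith
  qed (fact lim c_pos)+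
  have p_QA: "p_QA E \<beta> \<Gamma> \<sigma>\<^sub>1 = X a / sum X UNIV"
  proof -
    have "(\<Sum>\<sigma>\<in>Assignments. \<sigma> \<bullet> (mat_exp (- \<beta> *\<^sub>R Ham E \<Gamma>) *v \<sigma>)) = sum X UNIV"
      unfolding Assignments_eq_Basis Basis_vec_real
      by (subst sum.reindex) (auto simp: inj_def axis_eq_axis X_def axis_inner_matrix_axis)
    then show ?thesis
      by (simp only: p_QA_def a axis_inner_matrix_axis X_def)
  qed
  have "\<forall>\<^sub>F m in at_top. p_QA E \<beta> \<Gamma> \<sigma>\<^sub>1 -
      (\<Sum>\<sigma>\<in>{2..m} \<rightarrow>\<^sub>E Assignments. p_QA_ST E \<beta> \<Gamma> m (\<sigma>(1 := \<sigma>\<^sub>1)))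
      = X a / sum X UNIV - x m a / sum (x m) UNIV"
    using eventually_ge_at_top[of 1]
  proof eventually_elim
    case (elim m)
    let ?s = "trotter_scale E \<beta> \<Gamma> m"
    \<comment> \<open>The scale must be nonzero before its m-th power can be cancelled; both factors
      of its denominator are positive because \<beta> \<Gamma>/m > 0 for m \<ge> 1.\<close>
    have "(\<Sum>\<sigma>\<in>Assignments. exp (- (\<beta> / real m) * E \<sigma>)) > 0"
      unfolding Assignments_eq_Basis by (intro sum_pos) auto
    moreover have "exp (real CARD('k) * (\<beta> * \<Gamma> / real m)) > 1"
      using assms elim by simp
    ultimately have "?s \<noteq> 0"
      unfolding trotter_scale_def using assms elim by simp
    moreover have "(\<Sum>\<sigma>\<in>{2..m} \<rightarrow>\<^sub>E Assignments. p_QA_ST E \<beta> \<Gamma> m (\<sigma>(1 := \<sigma>\<^sub>1)))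
        = (?s ^ m * x m a) / (?s ^ m * sum (x m) UNIV)"
      using ST_weight_partial_sum[OF assms(1,2) elim, of E a] ST_weight_total_sum[OF assms(1,2) elim, of E]
      unfolding p_QA_ST_def a x_def by (simp only: sum_divide_distrib[symmetric])
    ultimately show ?case by (simp add: p_QA)
  qed
  from landau_o.big.in_cong[OF this] quotient show ?thesis by blast
qed

end
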